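(* Let $\Omega\subset\mathbb{R}^N$, $N\ge2$, be a bounded and regular domain, let $n\ge1$, and let $A(\cdot)$ be a real $n\times n$ symmetric matrix valued function on $\overline\Omega$ with continuous entries such that the Neumann problem $$\Delta u(x)+A(x)u(x)=0,\ x\in\Omega,\qquad \frac{\partial u(x)}{\partial n}=0,\ x\in\partial\Omega \qquad (\mathrm{N})$$ (with $u\in (H^1(\Omega))^n$) has no nontrivial constant solutions and $$\int_\Omega\langle A(x)k,k\rangle\,dx\ge0\quad\text{for all }k\in\mathbb{R}^n .$$ Suppose there exist a diagonal matrix function $B(x)$ with continuous diagonal entries $b_{ii}(x)$, $x\in\overline\Omega$, and numbers $p_i\in(N/2,\infty]$, $1\le i\le n$, such that $$A(x)\le B(x)\ \text{ for all }x\in\overline\Omega,\qquad \|b_{ii}^+\|_{p_i}<\beta_{p_i},\ 1\le i\le n .$$ Then problem $(\mathrm{N})$ has no nontrivial solution.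
   Context: $\partial/\partial n$ is the outer normal derivative on $\partial\Omega$; the Laplacian acts componentwise. $\langle\cdot,\cdot\rangle$ is the usual scalar product in $\mathbb{R}^n$. For $n\times n$ matrices, $C\le D$ means that $D-C$ is positive semi-definite. $f^+=\max\{f,0\}$ and $\|\cdot\|_p$ is the usual norm of $L^p(\Omega)$. Solutions of $(\mathrm{N})$ are $u\in(H^1(\Omega))^n$ in the usual weak sense: $\sum_{i}\int_\Omega\nabla u_i\cdot\nabla v_i\,dx=\int_\Omega\langle A(x)u,v\rangle\,dx$ for all $v\in(H^1(\Omega))^n$. The constants $\beta_p$, for $N/2<p\le\infty$, depend on $p$ and $\Omega$ and are defined by $\beta_p=\min_{X_p\setminus\{0\}}I_p$ (the minimum is attained), where: for $N/2<p<\infty$: $X_p=\{v\in H^1(\Omega):\int_\Omega|v|^{\frac{2}{p-1}}v=0\}$ and $I_p(v)=\dfrac{\int_\Omega|\nabla v|^2}{\left(\int_\Omega|v|^{\frac{2p}{p-1}}\right)^{\frac{p-1}{p}}}$; for $p=\infty$: $X_\infty=\{v\in H^1(\Omega):\int_\Omega v=0\}$ and $I_\infty(v)=\dfrac{\int_\Omega|\nabla v|^2}{\int_\Omega v^2}$. *)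

theory Defs
  imports "HOL-Analysis.Analysis" "HOL-Probability.Essential_Supremum"
begin

definition C1_function :: "('a::euclidean_space \<Rightarrow> real) \<Rightarrow> bool" where
  "C1_function \<gamma> \<longleftrightarrow>
     (\<exists>g. continuous_on UNIV g \<and> (\<forall>x. (\<gamma> has_derivative (\<lambda>h. g x \<bullet> h)) (at x)))"

text \<open>
  Boundary of class C1: near each boundary point the set is, in suitable orthonormal coordinates,
  the region above the graph of a C1 function. The unit vector \<open>e\<close> is the ``vertical'' direction;
  \<open>\<gamma>\<close> is only evaluated at orthogonal projections onto the hyperplane \<open>e\<^sup>\<bottom>\<close>, so it plays the role
  of a C1 function of the remaining variables.
\<close>

definition C1_boundary :: "('a::euclidean_space) set \<Rightarrow> bool" where
  "C1_boundary \<Omega> \<longleftrightarrow>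
     (\<forall>z \<in> frontier \<Omega>. \<exists>r>0. \<exists>e \<gamma>. norm e = 1 \<and> C1_function \<gamma> \<and>
        \<Omega> \<inter> ball z r = {x \<in> ball z r. \<gamma> (x - (x \<bullet> e) *\<^sub>R e) < x \<bullet> e})"

definition bounded_regular_domain :: "('a::euclidean_space) set \<Rightarrow> bool" where
  "bounded_regular_domain \<Omega> \<longleftrightarrow>
     open \<Omega> \<and> connected \<Omega> \<and> \<Omega> \<noteq> {} \<and> bounded \<Omega> \<and> C1_boundary \<Omega>"

text \<open>
  \<open>D [i\<^sub>1, \<dots>, i\<^sub>k]\<close> is the iterated partial derivative of \<open>\<phi>\<close>; all of them exist and are
  (Frechet) differentiable, hence continuous.
\<close>

definition smooth_function :: "(real^'N \<Rightarrow> real) \<Rightarrow> bool" where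
  "smooth_function \<phi> \<longleftrightarrow>
     (\<exists>D :: 'N list \<Rightarrow> real^'N \<Rightarrow> real. D [] = \<phi> \<and>
        (\<forall>is x. (D is has_derivative (\<lambda>h. \<Sum>i\<in>UNIV. D (i # is) x * h $ i)) (at x)))"

definition test_function :: "(real^'N) set \<Rightarrow> (real^'N \<Rightarrow> real) \<Rightarrow> bool" where
  "test_function \<Omega> \<phi> \<longleftrightarrow>
     smooth_function \<phi> \<and> compact (closure {x. \<phi> x \<noteq> 0}) \<and> closure {x. \<phi> x \<noteq> 0} \<subseteq> \<Omega>"

definition partial_deriv :: "'N \<Rightarrow> (real^'N \<Rightarrow> real) \<Rightarrow> real^'N \<Rightarrow> real" where
  "partial_deriv i \<phi> x = frechet_derivative \<phi> (at x) (axis i 1)"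

definition L2_on :: "(real^'N) set \<Rightarrow> (real^'N \<Rightarrow> 'b::euclidean_space) \<Rightarrow> bool" where
  "L2_on \<Omega> f \<longleftrightarrow>
     f \<in> borel_measurable (lebesgue_on \<Omega>) \<and> integrable (lebesgue_on \<Omega>) (\<lambda>x. (norm (f x))\<^sup>2)"

text \<open>
  \<open>H1_grad \<Omega> v G\<close>: \<open>v \<in> H\<^sup>1(\<Omega>)\<close> with weak gradient \<open>G\<close>. Elements of the Sobolev space are
  represented by functions of which only the values on \<open>\<Omega>\<close>, up to null sets, matter;
  the weak gradient is unique up to null sets.
\<close>

definition H1_grad :: "(real^'N) set \<Rightarrow> (real^'N \<Rightarrow> real) \<Rightarrow> (real^'N \<Rightarrow> real^'N) \<Rightarrow> bool" where
  "H1_grad \<Omega> v G \<longleftrightarrow> L2_on \<Omega> v \<and> L2_on \<Omega> G \<and>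
     (\<forall>\<phi> i. test_function \<Omega> \<phi> \<longrightarrow>
        (LINT x|lebesgue_on \<Omega>. v x * partial_deriv i \<phi> x)
          = - (LINT x|lebesgue_on \<Omega>. G x $ i * \<phi> x))"

definition H1 :: "(real^'N) set \<Rightarrow> (real^'N \<Rightarrow> real) set" where
  "H1 \<Omega> = {v. \<exists>G. H1_grad \<Omega> v G}"

text \<open>The exponent \<open>p = \<infinity>\<close> is allowed throughout.\<close>

definition X_space :: "(real^'N) set \<Rightarrow> ereal \<Rightarrow> (real^'N \<Rightarrow> real) set" where
  "X_space \<Omega> p =
     (if p = \<infinity> then {v \<in> H1 \<Omega>. (LINT x|lebesgue_on \<Omega>. v x) = 0}
      else {v \<in> H1 \<Omega>.
        (LINT x|lebesgue_on \<Omega>. \<bar>v x\<bar> powr (2 / (real_of_ereal p - 1)) * v x) = 0})"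

definition I_functional ::
  "(real^'N) set \<Rightarrow> ereal \<Rightarrow> (real^'N \<Rightarrow> real) \<Rightarrow> (real^'N \<Rightarrow> real^'N) \<Rightarrow> real" where
  "I_functional \<Omega> p v G =
     (if p = \<infinity> then
        (LINT x|lebesgue_on \<Omega>. (norm (G x))\<^sup>2) / (LINT x|lebesgue_on \<Omega>. (v x)\<^sup>2)
      else
        (LINT x|lebesgue_on \<Omega>. (norm (G x))\<^sup>2) /
        (LINT x|lebesgue_on \<Omega>. \<bar>v x\<bar> powr (2 * real_of_ereal p / (real_of_ereal p - 1)))
          powr ((real_of_ereal p - 1) / real_of_ereal p))"

text \<open>
  The minimum of \<open>I\<^sub>p\<close> over the nonzero elements of \<open>X\<^sub>p\<close>, written as an infimum (the minimum is
  attained). For a bounded regular domain in dimension \<open>N \<ge> 2\<close> and \<open>p > N/2\<close> the exponent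
  \<open>2p/(p-1)\<close> is below the critical Sobolev exponent, so that all integrals in the definitions of
  \<open>X_space\<close> and \<open>I_functional\<close> converge.
\<close>

definition \<beta> :: "(real^'N) set \<Rightarrow> ereal \<Rightarrow> real" where
  "\<beta> \<Omega> p = Inf {I_functional \<Omega> p v G | v G.
     v \<in> X_space \<Omega> p \<and> H1_grad \<Omega> v G \<and> \<not> (AE x in lebesgue_on \<Omega>. v x = 0)}"

text \<open>
  The norm of \<open>L\<^sup>p(\<Omega>)\<close>, meaningful for elements of \<open>L\<^sup>p(\<Omega>)\<close>; in particular for
  continuous functions on the closure of a nonempty bounded open set.
\<close>

definition Lp_norm :: "(real^'N) set \<Rightarrow> ereal \<Rightarrow> (real^'N \<Rightarrow> real) \<Rightarrow> real" where
  "Lp_norm \<Omega> p f =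
     (if p = \<infinity> then real_of_ereal (esssup (lebesgue_on \<Omega>) (\<lambda>x. ereal \<bar>f x\<bar>))
      else (LINT x|lebesgue_on \<Omega>. \<bar>f x\<bar> powr real_of_ereal p) powr (1 / real_of_ereal p))"

text \<open>Used for symmetric matrices only: \<open>D - C\<close> is positive semi-definite.\<close>

definition matrix_le :: "real^'n^'n \<Rightarrow> real^'n^'n \<Rightarrow> bool" where
  "matrix_le C D \<longleftrightarrow> (\<forall>k. 0 \<le> ((D - C) *v k) \<bullet> k)"

definition diagonal_matrix :: "real^'n^'n \<Rightarrow> bool" where
  "diagonal_matrix M \<longleftrightarrow> (\<forall>i j. i \<noteq> j \<longrightarrow> M $ i $ j = 0)"

text \<open>
  Weak solutions of the Neumann problem \<open>\<Delta>u + A(x)u = 0\<close> in \<open>\<Omega>\<close>, \<open>\<partial>u/\<partial>n = 0\<close> on \<open>\<partial>\<Omega>\<close>;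
  the \<open>i\<close>-th row of \<open>G x\<close> is the weak gradient of the \<open>i\<close>-th component of \<open>u\<close>, and similarly
  for \<open>H\<close> and the test function \<open>v\<close>.
\<close>

definition neumann_solution ::
  "(real^'N) set \<Rightarrow> (real^'N \<Rightarrow> real^'n^'n) \<Rightarrow> (real^'N \<Rightarrow> real^'n) \<Rightarrow> bool" where
  "neumann_solution \<Omega> A u \<longleftrightarrow>
     (\<exists>G :: real^'N \<Rightarrow> real^'N^'n. (\<forall>i. H1_grad \<Omega> (\<lambda>x. u x $ i) (\<lambda>x. G x $ i)) \<and>
        (\<forall>(v :: real^'N \<Rightarrow> real^'n) (H :: real^'N \<Rightarrow> real^'N^'n).
           (\<forall>i. H1_grad \<Omega> (\<lambda>x. v x $ i) (\<lambda>x. H x $ i)) \<longrightarrow>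
           (\<Sum>i\<in>UNIV. LINT x|lebesgue_on \<Omega>. G x $ i \<bullet> H x $ i)
             = (LINT x|lebesgue_on \<Omega>. (A x *v u x) \<bullet> v x)))"

end

theory Submission
  imports Defs
begin

text \<open>
  Let \<open>u\<close> be a solution and \<open>k\<close> a constant vector. Testing the weak equation with \<open>u\<close> and with \<open>k\<close>,
  and using \<open>\<integral>\<langle>A k, k\<rangle> \<ge> 0\<close>, gives
  \<open>\<Sum>\<^sub>i \<integral>|\<nabla>u\<^sub>i|\<^sup>2 \<le> \<integral>\<langle>A (u + k), u + k\<rangle> \<le> \<Sum>\<^sub>i \<integral>b\<^sub>i\<^sub>i\<^sup>+ (u\<^sub>i + k\<^sub>i)\<^sup>2\<close>.
  Choose \<open>k\<^sub>i\<close> such that \<open>u\<^sub>i + k\<^sub>i\<close> lies in \<open>X\<^sub>p\<close> for \<open>p = p\<^sub>i\<close>. By Hoelder's inequality and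
  the definition of \<open>\<beta>\<^sub>p\<close>, the \<open>i\<close>-th term on the right is smaller than \<open>\<integral>|\<nabla>u\<^sub>i|\<^sup>2\<close> unless
  \<open>u\<^sub>i + k\<^sub>i = 0\<close>. Hence \<open>u = -k\<close> is a constant solution, and so vanishes.
\<close>

section \<open>Derivatives of test functions have integral 0\<close>

text \<open>Translation invariance of Lebesgue measure makes every difference quotient
  \<open>q n\<close> of \<open>\<phi>\<close> along \<open>e\<close> have integral 0. The quotients
  converge pointwise to \<open>\<psi>\<close> and, by the mean value theorem, are dominated by a
  constant on a compact set, so the limit has integral 0 as well.\<close>

lemma lborel_integral_directional_derivative_eq_0:
  fixes \<phi> \<psi> :: "'a::euclidean_space \<Rightarrow> real"
  assumes deriv: "\<And>x. ((\<lambda>t. \<phi> (x + t *\<^sub>R e)) has_real_derivative \<psi> x) (at 0)"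
    and \<phi>: "continuous_on UNIV \<phi>" and \<psi>: "continuous_on UNIV \<psi>"
    and K: "compact K" and supp: "\<And>x. x \<notin> K \<Longrightarrow> \<phi> x = 0"
  shows "integral\<^sup>L lborel \<psi> = 0"
proof -
  have deriv': "((\<lambda>t. \<phi> (x + t *\<^sub>R e)) has_real_derivative \<psi> (x + s *\<^sub>R e)) (at s)" for x s
  proof -
    have "((\<lambda>t. \<phi> (x + s *\<^sub>R e + t *\<^sub>R e)) has_real_derivative \<psi> (x + s *\<^sub>R e)) (at (s + - s))"
      using deriv[of "x + s *\<^sub>R e"] by simp
    then have "((\<lambda>t. \<phi> (x + s *\<^sub>R e + (t + - s) *\<^sub>R e)) has_real_derivative \<psi> (x + s *\<^sub>R e)) (at s)"
      by (subst (asm) DERIV_shift)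
    then show ?thesis by (simp add: algebra_simps)
  qed
  have \<psi>0: "\<psi> x = 0" if "x \<notin> K" for x
  proof -
    have "continuous_on UNIV (\<lambda>t::real. x + t *\<^sub>R e)" by (intro continuous_intros)
    moreover have "open (- K)" using K compact_imp_closed by blast
    ultimately have "open ((\<lambda>t::real. x + t *\<^sub>R e) -` (- K))"
      using open_vimage by blast
    moreover have "0 \<in> (\<lambda>t::real. x + t *\<^sub>R e) -` (- K)" using that by simp
    ultimately have "((\<lambda>t. 0) has_real_derivative \<psi> x) (at 0)"
      using has_field_derivative_transform_within_open[OF deriv[of x]] supp by fastforce
    then show ?thesis using DERIV_const DERIV_unique by blast
  qed
  obtain C where C: "\<And>x. x \<in> K \<Longrightarrow> norm (\<psi> x) \<le> C"
    using compact_imp_bounded[OF compact_continuous_image[OF continuous_on_subset[OF \<psi>] K]]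
    by (auto simp: bounded_iff)
  define M where "M = max C 0"
  have M: "\<bar>\<psi> x\<bar> \<le> M" for x
    using C[of x] \<psi>0[of x] by (cases "x \<in> K") (auto simp: M_def)
  define q where "q n x = (\<phi> (x + (1 / real (Suc n)) *\<^sub>R e) - \<phi> x) * real (Suc n)" for n x
  \<comment> \<open>\<open>K'\<close> collects the points from which \<open>K\<close> is reached by
    adding \<open>t *\<^sub>R e\<close> with \<open>t\<close> in [0, 1]. Outside it both values of
    \<open>\<phi>\<close> in \<open>q n\<close> vanish, because the increment
    \<open>1 / Suc n\<close> is at most 1.\<close>
  define K' where "K' = (\<lambda>(k, t). k - t *\<^sub>R e) ` (K \<times> {0..1::real})"
  have "compact K'"
    unfolding K'_def case_prod_beta by (intro compact_continuous_image continuous_intros compact_Times K) auto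
  have K'1: "x \<in> K'" if "x + t *\<^sub>R e \<in> K" "0 \<le> t" "t \<le> 1" for x t
    unfolding K'_def using that by (intro image_eqI[of _ _ "(x + t *\<^sub>R e, t)"]) auto
  have q_bound: "norm (q n x) \<le> M * indicator K' x" for n x
  proof (cases "x \<in> K'")
    case True
    have "\<exists>z>0. z < 1 / real (Suc n) \<and> \<phi> (x + (1 / real (Suc n)) *\<^sub>R e) - \<phi> (x + 0 *\<^sub>R e)
            = (1 / real (Suc n) - 0) * \<psi> (x + z *\<^sub>R e)"
      by (intro MVT2) (auto intro: deriv')
    then obtain z where "\<phi> (x + (1 / real (Suc n)) *\<^sub>R e) - \<phi> x = (1 / real (Suc n)) * \<psi> (x + z *\<^sub>R e)"
      by auto
    then have "q n x = \<psi> (x + z *\<^sub>R e)" by (simp add: q_def)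
    then show ?thesis using True M by simp
  next
    case False
    then have "x \<notin> K" "x + (1 / real (Suc n)) *\<^sub>R e \<notin> K"
      using K'1[of x 0] K'1[of x "1 / real (Suc n)"] by auto
    then show ?thesis using False by (simp add: q_def supp)
  qed
  have \<phi>_int: "integrable lborel \<phi>"
  proof -
    have "integrable lborel (\<lambda>x. indicator K x *\<^sub>R \<phi> x)"
      using borel_integrable_compact[OF K continuous_on_subset[OF \<phi>]] by simp
    also have "(\<lambda>x. indicator K x *\<^sub>R \<phi> x) = \<phi>" using supp by (force simp: indicator_def)
    finally show ?thesis .
  qed
  have \<phi>_meas [measurable]: "\<phi> \<in> borel_measurable borel" and \<psi>_meas [measurable]: "\<psi> \<in> borel_measurable borel"
    using \<phi> \<psi> by (auto intro: borel_measurable_continuous_onI)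
  have q0: "integral\<^sup>L lborel (q n) = 0" for n
  proof -
    let ?c = "(1 / real (Suc n)) *\<^sub>R e"
    have i: "integrable lborel (\<lambda>x. \<phi> (x + ?c))"
    proof -
      have "integrable (distr lborel borel ((+) ?c)) \<phi>"
        by (subst lborel_distr_plus) (rule \<phi>_int)
      then have "integrable lborel (\<lambda>x. \<phi> (?c + x))" by (subst (asm) integrable_distr_eq) auto
      then show ?thesis by (simp add: add.commute)
    qed
    have "integral\<^sup>L lborel \<phi> = integral\<^sup>L (distr lborel borel ((+) ?c)) \<phi>"
      by (subst lborel_distr_plus) simp
    also have "\<dots> = integral\<^sup>L lborel (\<lambda>x. \<phi> (?c + x))" by (rule integral_distr) auto
    finally have "integral\<^sup>L lborel (\<lambda>x. \<phi> (x + ?c)) = integral\<^sup>L lborel \<phi>" by (simp add: add.commute)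
    then show ?thesis
      unfolding q_def using i \<phi>_int by (simp add: Bochner_Integration.integral_diff del: of_nat_Suc)
  qed
  have lim: "(\<lambda>n. q n x) \<longlonglongrightarrow> \<psi> x" for x
  proof -
    have "((\<lambda>h. (\<phi> (x + h *\<^sub>R e) - \<phi> x) / h) \<longlongrightarrow> \<psi> x) (at 0)"
      using deriv[of x] by (simp add: DERIV_def)
    moreover have "filterlim (\<lambda>n. 1 / real (Suc n)) (at 0) sequentially"
      using LIMSEQ_inverse_real_of_nat by (auto simp: filterlim_at inverse_eq_divide)
    ultimately have "(\<lambda>n. (\<phi> (x + (1 / real (Suc n)) *\<^sub>R e) - \<phi> x) / (1 / real (Suc n))) \<longlonglongrightarrow> \<psi> x"
      by (rule filterlim_compose)
    then show ?thesis by (simp add: q_def)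
  qed
  have "(\<lambda>n. integral\<^sup>L lborel (q n)) \<longlonglongrightarrow> integral\<^sup>L lborel \<psi>"
  proof (rule integral_dominated_convergence)
    show "integrable lborel (\<lambda>x. M * indicator K' x)"
      using borel_integrable_compact[OF \<open>compact K'\<close>, of "\<lambda>_. M"] by (simp add: mult.commute)
    show "q n \<in> borel_measurable lborel" for n unfolding q_def by measurable
  qed (use \<psi>_meas lim q_bound in auto)
  then show ?thesis by (simp add: q0 LIMSEQ_const_iff)
qed

lemma smooth_function_partial_deriv:
  fixes \<phi> :: "real^'N \<Rightarrow> real"
  assumes "smooth_function \<phi>"
  shows continuous_on_smooth_function: "continuous_on UNIV \<phi>"
    and continuous_on_partial_deriv: "continuous_on UNIV (partial_deriv i \<phi>)"
    and has_real_derivative_partial_deriv: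
      "((\<lambda>t. \<phi> (x + t *\<^sub>R axis i 1)) has_real_derivative partial_deriv i \<phi> x) (at 0)"
proof -
  obtain D where D0: "D [] = \<phi>"
    and D: "\<And>is x. (D is has_derivative (\<lambda>h. \<Sum>i\<in>UNIV. D (i # is) x * h $ i)) (at x)"
    using assms unfolding smooth_function_def by blast
  \<comment> \<open>Uniqueness of the Frechet derivative identifies the partial derivative with a
    member of the family \<open>D\<close>, whose own differentiability then yields
    continuity.\<close>
  have pd: "partial_deriv i \<phi> = D [i]"
  proof
    fix x
    show "partial_deriv i \<phi> x = D [i] x"
      unfolding partial_deriv_def
      by (subst frechet_derivative_at[OF D[of "[]" x, unfolded D0], symmetric])
         (simp add: axis_def if_distrib cong: if_cong)
  qed
  have cont: "continuous_on UNIV (D is)" for "is"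
    by (intro continuous_at_imp_continuous_on ballI has_derivative_continuous[OF D])
  show "continuous_on UNIV \<phi>" "continuous_on UNIV (partial_deriv i \<phi>)"
    using cont[of "[]"] cont[of "[i]"] by (simp_all add: D0 pd)
  have "((\<lambda>t::real. x + t *\<^sub>R axis i 1) has_derivative (\<lambda>t. t *\<^sub>R axis i 1)) (at 0)"
    by (auto intro!: derivative_eq_intros)
  from diff_chain_at[OF this, of \<phi> "\<lambda>h. \<Sum>j\<in>UNIV. D [j] x * h $ j"] D[of "[]" x] D0
  have "((\<lambda>t. \<phi> (x + t *\<^sub>R axis i 1)) has_derivative
          (\<lambda>t. \<Sum>j\<in>UNIV. D [j] x * (t *\<^sub>R axis i 1 :: real^'N) $ j)) (at 0)"
    by (auto simp: o_def)
  moreover have "(\<lambda>t. \<Sum>j\<in>UNIV. D [j] x * (t *\<^sub>R axis i 1 :: real^'N) $ j) = (\<lambda>t. D [i] x * t)"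
    by (auto simp: axis_def if_distrib cong: if_cong)
  ultimately show "((\<lambda>t. \<phi> (x + t *\<^sub>R axis i 1)) has_real_derivative partial_deriv i \<phi> x) (at 0)"
    by (simp add: has_field_derivative_def pd)
qed

lemma partial_deriv_eq_0:
  fixes \<phi> :: "real^'N \<Rightarrow> real"
  assumes "x \<notin> closure {x. \<phi> x \<noteq> 0}"
  shows "partial_deriv i \<phi> x = 0"
proof -
  have "(\<phi> has_derivative (\<lambda>h. 0)) (at x)"
  proof (rule has_derivative_transform_within_open[where s = "- closure {x. \<phi> x \<noteq> 0}" and f = "\<lambda>_. 0"])
    show "0 = \<phi> y" if "y \<in> - closure {x. \<phi> x \<noteq> 0}" for y
      using that closure_subset[of "{x. \<phi> x \<noteq> 0}"] by fastforce
  qed (use assms in auto)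
  from frechet_derivative_at[OF this] show ?thesis
    by (metis partial_deriv_def)
qed

lemma bounded_range_partial_deriv_test_function:
  assumes "test_function \<Omega> \<phi>"
  obtains C where "\<And>x. \<bar>partial_deriv i \<phi> x\<bar> \<le> C"
proof -
  let ?K = "closure {x. \<phi> x \<noteq> 0}"
  have "compact ?K" "smooth_function \<phi>" using assms by (auto simp: test_function_def)
  then have "bounded (partial_deriv i \<phi> ` ?K)"
    by (meson compact_continuous_image compact_imp_bounded continuous_on_partial_deriv
        continuous_on_subset subset_UNIV)
  then obtain C where C: "\<And>x. x \<in> ?K \<Longrightarrow> \<bar>partial_deriv i \<phi> x\<bar> \<le> C" by (auto simp: bounded_iff)
  have "\<bar>partial_deriv i \<phi> x\<bar> \<le> max C 0" for x
    using C[of x] partial_deriv_eq_0[of x \<phi> i] by (cases "x \<in> ?K") auto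
  then show ?thesis using that by blast
qed

lemma borel_measurable_partial_deriv_test_function:
  assumes "test_function \<Omega> \<phi>"
  shows "partial_deriv i \<phi> \<in> borel_measurable (lebesgue_on \<Omega>)"
proof -
  have "partial_deriv i \<phi> \<in> borel_measurable borel"
    using assms by (intro borel_measurable_continuous_onI continuous_on_partial_deriv) (auto simp: test_function_def)
  then show ?thesis by (intro measurable_restrict_space1 measurable_completion) simp
qed

text \<open>This is the reason why constants have weak gradient 0. The support of
  \<open>\<phi>\<close> lies in \<open>\<Omega>\<close>, so the integral extends unchanged to the
  whole space, where the result on directional derivatives applies with
  \<open>e = axis i 1\<close>.\<close>

lemma integral_partial_deriv_test_function:
  fixes \<Omega> :: "(real^'N) set"
  assumes \<Omega>: "\<Omega> \<in> sets lebesgue" and \<phi>: "test_function \<Omega> \<phi>"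
  shows "(LINT x|lebesgue_on \<Omega>. partial_deriv i \<phi> x) = 0"
proof -
  let ?K = "closure {x. \<phi> x \<noteq> 0}"
  have K: "compact ?K" "?K \<subseteq> \<Omega>" and smooth: "smooth_function \<phi>"
    using \<phi> by (auto simp: test_function_def)
  have "(LINT x|lebesgue_on \<Omega>. partial_deriv i \<phi> x) = (LINT x|lebesgue. indicator \<Omega> x *\<^sub>R partial_deriv i \<phi> x)"
    using \<Omega> by (simp add: integral_restrict_space)
  also have "\<dots> = (LINT x|lebesgue. partial_deriv i \<phi> x)"
    using partial_deriv_eq_0[of _ \<phi> i] K(2)
    by (intro Bochner_Integration.integral_cong) (auto simp: indicator_def)
  also have "\<dots> = integral\<^sup>L lborel (partial_deriv i \<phi>)"
    by (intro integral_completion)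
       (use continuous_on_partial_deriv[OF smooth] in \<open>auto intro: borel_measurable_continuous_onI\<close>)
  also have "\<dots> = 0"
  proof (rule lborel_integral_directional_derivative_eq_0[OF has_real_derivative_partial_deriv[OF smooth]])
    show "\<phi> x = 0" if "x \<notin> ?K" for x
      using that closure_subset[of "{x. \<phi> x \<noteq> 0}"] by blast
  qed (use smooth K(1) in \<open>auto intro: continuous_on_partial_deriv continuous_on_smooth_function\<close>)
  finally show ?thesis .
qed

section \<open>Hoelder's inequality\<close>

text \<open>Young's inequality is applied pointwise to \<open>f / a\<close> and
  \<open>g / b\<close>, with \<open>a\<close> and \<open>b\<close> the two norms, and integrated;
  the right-hand side becomes \<open>1 / p + 1 / q = 1\<close>. If a norm is 0, this normalization
  fails, but then the product vanishes almost everywhere.\<close>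

lemma Holder_integral:
  fixes f g :: "'a \<Rightarrow> real"
  assumes pq: "1 < p" "1 < q" "1 / p + 1 / q = 1"
    and [measurable]: "f \<in> borel_measurable M" "g \<in> borel_measurable M"
    and nonneg: "\<And>x. x \<in> space M \<Longrightarrow> 0 \<le> f x" "\<And>x. x \<in> space M \<Longrightarrow> 0 \<le> g x"
    and f: "integrable M (\<lambda>x. f x powr p)" and g: "integrable M (\<lambda>x. g x powr q)"
  shows "integral\<^sup>L M (\<lambda>x. f x * g x)
    \<le> (integral\<^sup>L M (\<lambda>x. f x powr p)) powr (1 / p) * (integral\<^sup>L M (\<lambda>x. g x powr q)) powr (1 / q)"
proof -
  define F where "F = integral\<^sup>L M (\<lambda>x. f x powr p)"
  define G where "G = integral\<^sup>L M (\<lambda>x. g x powr q)"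
  have "F \<ge> 0" "G \<ge> 0" by (auto simp: F_def G_def)
  have zero: "integral\<^sup>L M (\<lambda>x. f x * g x) = 0" if "F = 0 \<or> G = 0"
  proof -
    have "AE x in M. f x = 0 \<or> g x = 0"
      using that
    proof
      assume "F = 0"
      then have "AE x in M. f x powr p = 0"
        using integral_nonneg_eq_0_iff_AE[OF f] by (auto simp: F_def)
      then show ?thesis by auto
    next
      assume "G = 0"
      then have "AE x in M. g x powr q = 0"
        using integral_nonneg_eq_0_iff_AE[OF g] by (auto simp: G_def)
      then show ?thesis by auto
    qed
    then show ?thesis by (subst integral_eq_zero_AE) auto
  qed
  show ?thesis
  proof (cases "F = 0 \<or> G = 0")
    case True
    then show ?thesis using zero by simp
  next
    case False
    then have pos: "F > 0" "G > 0" using \<open>F \<ge> 0\<close> \<open>G \<ge> 0\<close> by auto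
    define a where "a = F powr (1 / p)"
    define b where "b = G powr (1 / q)"
    have ab: "a > 0" "b > 0" "a powr p = F" "b powr q = G"
      using pos pq by (auto simp: a_def b_def powr_powr)
    have "integral\<^sup>L M (\<lambda>x. f x * g x)
        \<le> integral\<^sup>L M (\<lambda>x. a * b * (f x powr p / (F * p) + g x powr q / (G * q)))"
    \<comment> \<open>Integrability is shown for the majorant alone. As the majorant is nonnegative,
      the bound also covers the default value 0 of the integral on the left.\<close>
    proof (rule integral_mono')
      show "integrable M (\<lambda>x. a * b * (f x powr p / (F * p) + g x powr q / (G * q)))"
        using f g by auto
      fix x assume x: "x \<in> space M"
      have "f x / a * (g x / b) \<le> (f x / a) powr p / p + (g x / b) powr q / q"
        using Youngs_inequality[OF pq, of "f x / a" "g x / b"] nonneg[OF x] ab by simp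
      also have "\<dots> = f x powr p / (F * p) + g x powr q / (G * q)"
        using nonneg[OF x] ab by (simp add: powr_divide)
      finally show "f x * g x \<le> a * b * (f x powr p / (F * p) + g x powr q / (G * q))"
        using ab by (simp add: field_simps)
      show "0 \<le> a * b * (f x powr p / (F * p) + g x powr q / (G * q))"
        using nonneg[OF x] ab pos pq by auto
    qed
    also have "\<dots> = a * b * (F / (F * p) + G / (G * q))"
      using f g by (simp add: F_def G_def)
    also have "\<dots> = a * b * (1 / p + 1 / q)" using pos by simp
    also have "\<dots> = a * b" using pq by simp
    finally show ?thesis by (simp add: a_def b_def F_def G_def)
  qed
qed

section \<open>Zeros of the integral of a shifted power\<close>

lemma continuous_on_abs_powr_times:
  fixes q :: real
  assumes "0 \<le> q"
  shows "continuous_on UNIV (\<lambda>t::real. \<bar>t\<bar> powr q * t)"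
\<comment> \<open>Continuity of \<open>powr\<close> at base 0 requires a positive exponent. For
  \<open>q = 0\<close> the function is the identity: \<open>0 powr 0\<close> is 0 in HOL, but the
  factor \<open>t\<close> vanishes there anyway.\<close>
proof (cases "q = 0")
  case True
  then have *: "(\<lambda>t::real. \<bar>t\<bar> powr q * t) = (\<lambda>t. t)" by auto
  show ?thesis unfolding * by simp
next
  case False
  then show ?thesis using assms by (intro continuous_intros continuous_on_powr') auto
qed

lemma exists_shift_integral_abs_powr_times_eq_0:
  fixes w :: "'a \<Rightarrow> real"
  assumes M: "finite_measure M" and q: "0 \<le> q" and [measurable]: "w \<in> borel_measurable M"
  shows "\<exists>c. (LINT x|M. \<bar>w x + c\<bar> powr q * (w x + c)) = 0"
proof -
  interpret finite_measure M by (rule M)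
  define f where "f t = \<bar>t\<bar> powr q * t" for t :: real
  have cf: "continuous_on UNIV f" using continuous_on_abs_powr_times[OF q] by (simp add: f_def)
  have [measurable]: "f \<in> borel_measurable borel"
    using cf by (rule borel_measurable_continuous_onI)
  have abs_f: "\<bar>f t\<bar> = \<bar>t\<bar> powr (q + 1)" for t
    by (cases "t = 0") (auto simp: f_def abs_mult powr_add)
  have hom: "f (a * t) = a powr (q + 1) * f t" if "a > 0" for a t
    using that by (simp add: f_def abs_mult powr_mult powr_add)
  define H where "H a s = (LINT x|M. f (a * w x + s))" for a s
  \<comment> \<open>\<open>H 0 1 > 0 > H 0 (-1)\<close>; by continuity the signs persist for small \<open>a > 0\<close>, so \<open>H a\<close> has a zero,
    and homogeneity of \<open>f\<close> turns it into a zero of \<open>H 1\<close>. In the non-integrable case the shift 0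
    works, because the integral then has the junk value 0.\<close>
  have "\<exists>c. H 1 c = 0"
  proof (cases "integrable M (\<lambda>x. f (w x))")
    case False
    then have "H 1 0 = 0" by (simp add: H_def not_integrable_integral_eq)
    then show ?thesis by blast
  next
    case True
    \<comment> \<open>One majorant serves for all \<open>a\<close> and \<open>s\<close> in a bounded
      range; it is integrable because \<open>f (w x)\<close> is and the measure is finite.\<close>
    have dom: "\<bar>f (a * w x + s)\<bar> \<le> (2 * R) powr (q + 1) * (\<bar>f (w x)\<bar> + 1)"
      if "\<bar>a\<bar> \<le> R" "\<bar>s\<bar> \<le> R" for a s x R
    proof -
      have "\<bar>a * w x + s\<bar> \<le> R * \<bar>w x\<bar> + R"
        using that mult_right_mono[OF that(1), of "\<bar>w x\<bar>"] by (auto simp: abs_mult intro: order_trans[OF abs_triangle_ineq])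
      also have "\<dots> \<le> 2 * R * max \<bar>w x\<bar> 1"
        using that mult_left_mono[of "\<bar>w x\<bar>" "max \<bar>w x\<bar> 1" R] mult_left_mono[of 1 "max \<bar>w x\<bar> 1" R] by linarith
      finally have "\<bar>f (a * w x + s)\<bar> \<le> (2 * R * max \<bar>w x\<bar> 1) powr (q + 1)"
        unfolding abs_f using q by (intro powr_mono2) auto
      also have "\<dots> = (2 * R) powr (q + 1) * max \<bar>w x\<bar> 1 powr (q + 1)"
        by (rule powr_mult)
      also have "\<dots> \<le> (2 * R) powr (q + 1) * (\<bar>f (w x)\<bar> + 1)"
        unfolding abs_f by (intro mult_left_mono) (auto simp: max_def)
      finally show ?thesis .
    qed
    \<comment> \<open>Joint continuity of \<open>H\<close> is used twice: at \<open>a' = 0\<close>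
      to carry the signs of \<open>H 0 1\<close> and \<open>H 0 (-1)\<close> over to small
      \<open>a > 0\<close>, and for fixed \<open>a\<close> to apply the intermediate value theorem
      in \<open>s\<close>.\<close>
    have lim: "(\<lambda>n. H (a n) (s n)) \<longlonglongrightarrow> H a' s'" if a: "a \<longlonglongrightarrow> a'" and s: "s \<longlonglongrightarrow> s'" for a s a' s'
    proof -
      obtain R1 where R1: "\<And>n. \<bar>a n\<bar> \<le> R1"
        using BseqE[OF convergent_imp_Bseq[OF convergentI[OF a]]] by auto
      obtain R2 where R2: "\<And>n. \<bar>s n\<bar> \<le> R2"
        using BseqE[OF convergent_imp_Bseq[OF convergentI[OF s]]] by auto
      define R where "R = max R1 R2"
      have R: "\<bar>a n\<bar> \<le> R" "\<bar>s n\<bar> \<le> R" for n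
        using R1[of n] R2[of n] by (auto simp: R_def)
      show ?thesis
        unfolding H_def
      proof (rule integral_dominated_convergence)
        show "integrable M (\<lambda>x. (2 * R) powr (q + 1) * (\<bar>f (w x)\<bar> + 1))"
          using True by auto
        show "AE x in M. (\<lambda>n. f (a n * w x + s n)) \<longlonglongrightarrow> f (a' * w x + s')"
          by (intro AE_I2 continuous_on_tendsto_compose[OF cf] tendsto_intros a s) auto
        show "AE x in M. norm (f (a n * w x + s n)) \<le> (2 * R) powr (q + 1) * (\<bar>f (w x)\<bar> + 1)" for n
          using dom[OF R] by auto
      qed measurable
    qed
    have H0: "H 0 1 = measure M (space M)" "H 0 (-1) = - measure M (space M)"
      by (auto simp: H_def f_def)
    show ?thesis
    \<comment> \<open>On a null space there is no change of sign, but every integral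
      vanishes.\<close>
    proof (cases "measure M (space M) = 0")
      case True
      then have "H 1 0 = 0"
        unfolding H_def
        by (intro integral_eq_zero_AE AE_I[of _ _ "space M"]) (auto simp: emeasure_eq_measure)
      then show ?thesis by blast
    next
      case False
      then have pos: "measure M (space M) > 0" using measure_nonneg[of M "space M"] by linarith
      have inv: "(\<lambda>n. 1 / real (Suc n)) \<longlonglongrightarrow> 0"
        using LIMSEQ_inverse_real_of_nat by (simp add: inverse_eq_divide)
      have "eventually (\<lambda>n. H (1 / real (Suc n)) 1 > 0) sequentially"
        using order_tendstoD(1)[OF lim[OF inv tendsto_const[of 1]]] H0 pos by simp
      moreover have "eventually (\<lambda>n. H (1 / real (Suc n)) (-1) < 0) sequentially"
        using order_tendstoD(2)[OF lim[OF inv tendsto_const[of "-1"]]] H0 pos by simp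
      ultimately have "eventually (\<lambda>n. H (1 / real (Suc n)) 1 > 0 \<and> H (1 / real (Suc n)) (-1) < 0) sequentially"
        by (rule eventually_conj)
      then obtain a where a: "a > 0" "H a 1 > 0" "H a (-1) < 0"
        by (auto simp: eventually_sequentially simp del: of_nat_Suc)
          (metis order_refl of_nat_0_less_iff zero_less_Suc zero_less_divide_1_iff)
      have "continuous_on {-1..1} (H a)"
        unfolding continuous_on_sequentially by (auto simp: o_def intro: lim)
      then obtain s where "H a s = 0"
        using IVT'[of "H a" "-1" 0 1] a by auto
      moreover have "H a s = a powr (q + 1) * H 1 (s / a)"
      proof -
        have "f (a * w x + s) = a powr (q + 1) * f (1 * w x + s / a)" for x
        proof -
          have "a * w x + s = a * (1 * w x + s / a)" using a(1) by (simp add: distrib_left)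
          then show ?thesis using hom[OF a(1)] by metis
        qed
        then show ?thesis by (simp add: H_def)
      qed
      ultimately have "H 1 (s / a) = 0" using a(1) by simp
      then show ?thesis by blast
    qed
  qed
  then show ?thesis by (simp add: H_def f_def)
qed

section \<open>Products in \<open>L2_on\<close>, and \<open>H1_grad\<close> under shifts by
  constants\<close>

lemma L2_on_const:
  assumes "finite_measure (lebesgue_on \<Omega>)"
  shows "L2_on \<Omega> (\<lambda>x. c)"
proof -
  interpret finite_measure "lebesgue_on \<Omega>" by fact
  show ?thesis by (simp add: L2_on_def)
qed

lemma L2_on_add:
  fixes u v :: "real^'N \<Rightarrow> real"
  assumes "L2_on \<Omega> u" "L2_on \<Omega> v"
  shows "L2_on \<Omega> (\<lambda>x. u x + v x)"
proof -
  have [measurable]: "u \<in> borel_measurable (lebesgue_on \<Omega>)" "v \<in> borel_measurable (lebesgue_on \<Omega>)"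
    using assms by (auto simp: L2_on_def)
  have "integrable (lebesgue_on \<Omega>) (\<lambda>x. (u x + v x)\<^sup>2)"
  proof (rule Bochner_Integration.integrable_bound)
    show "integrable (lebesgue_on \<Omega>) (\<lambda>x. 2 * (u x)\<^sup>2 + 2 * (v x)\<^sup>2)"
      using assms by (auto simp: L2_on_def)
    have "(u x + v x)\<^sup>2 \<le> 2 * (u x)\<^sup>2 + 2 * (v x)\<^sup>2" for x
      using zero_le_power2[of "u x - v x"] by (simp add: power2_eq_square algebra_simps)
    then show "AE x in lebesgue_on \<Omega>. norm ((u x + v x)\<^sup>2) \<le> norm (2 * (u x)\<^sup>2 + 2 * (v x)\<^sup>2)"
      by auto
  qed measurable
  then show ?thesis by (simp add: L2_on_def)
qed

text \<open>The form with three factors serves entries of \<open>A\<close> against components of two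
  vector functions, the weights \<open>b\<close> against squares, and derivatives of test functions
  against a single function (with \<open>v = 1\<close>).\<close>

lemma integrable_bounded_times_L2_on:
  fixes u v :: "real^'N \<Rightarrow> real"
  assumes a: "a \<in> borel_measurable (lebesgue_on \<Omega>)" "\<And>x. x \<in> \<Omega> \<Longrightarrow> \<bar>a x\<bar> \<le> C"
    and "L2_on \<Omega> u" "L2_on \<Omega> v"
  shows "integrable (lebesgue_on \<Omega>) (\<lambda>x. a x * u x * v x)"
proof (rule Bochner_Integration.integrable_bound)
  note a(1) [measurable]
  have [measurable]: "u \<in> borel_measurable (lebesgue_on \<Omega>)" "v \<in> borel_measurable (lebesgue_on \<Omega>)"
    using assms by (auto simp: L2_on_def)
  show "integrable (lebesgue_on \<Omega>) (\<lambda>x. C * ((u x)\<^sup>2 + (v x)\<^sup>2))"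
    using assms by (auto simp: L2_on_def)
  show "(\<lambda>x. a x * u x * v x) \<in> borel_measurable (lebesgue_on \<Omega>)" by measurable
  have "\<bar>a x * u x * v x\<bar> \<le> \<bar>C * ((u x)\<^sup>2 + (v x)\<^sup>2)\<bar>" if "x \<in> \<Omega>" for x
  proof -
    have "2 * (\<bar>u x\<bar> * \<bar>v x\<bar>) \<le> (u x)\<^sup>2 + (v x)\<^sup>2"
      using zero_le_power2[of "\<bar>u x\<bar> - \<bar>v x\<bar>"] by (simp add: power2_diff algebra_simps)
    then have "\<bar>u x\<bar> * \<bar>v x\<bar> \<le> (u x)\<^sup>2 + (v x)\<^sup>2"
      using mult_nonneg_nonneg[of "\<bar>u x\<bar>" "\<bar>v x\<bar>"] by linarith
    with a(2)[OF that] have "\<bar>a x\<bar> * (\<bar>u x\<bar> * \<bar>v x\<bar>) \<le> C * ((u x)\<^sup>2 + (v x)\<^sup>2)"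
      by (intro mult_mono) auto
    also have "\<dots> \<le> \<bar>C * ((u x)\<^sup>2 + (v x)\<^sup>2)\<bar>" by (rule abs_ge_self)
    finally show ?thesis by (simp add: abs_mult mult.assoc)
  qed
  then show "AE x in lebesgue_on \<Omega>. norm (a x * u x * v x) \<le> norm (C * ((u x)\<^sup>2 + (v x)\<^sup>2))"
    by (intro AE_I2) (simp add: space_restrict_space)
qed

lemma H1_grad_const:
  fixes \<Omega> :: "(real^'N) set"
  assumes "\<Omega> \<in> sets lebesgue" "finite_measure (lebesgue_on \<Omega>)"
  shows "H1_grad \<Omega> (\<lambda>x. c) (\<lambda>x. 0)"
  unfolding H1_grad_def
  using integral_partial_deriv_test_function[OF assms(1)] by (auto intro: L2_on_const[OF assms(2)])

text \<open>The additional term \<open>c * partial_deriv i \<phi> x\<close> integrates to 0; hence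
  the shift by \<open>k\<close> leaves the Dirichlet energy unchanged.\<close>

lemma H1_grad_add_const:
  fixes \<Omega> :: "(real^'N) set"
  assumes \<Omega>: "\<Omega> \<in> sets lebesgue" "finite_measure (lebesgue_on \<Omega>)" and v: "H1_grad \<Omega> v G"
  shows "H1_grad \<Omega> (\<lambda>x. v x + c) G"
  unfolding H1_grad_def
proof (intro conjI allI impI)
  show "L2_on \<Omega> G" using v by (auto simp: H1_grad_def)
  have L2: "L2_on \<Omega> v" "L2_on \<Omega> (\<lambda>x. c)"
    using v L2_on_const[OF \<Omega>(2)] by (auto simp: H1_grad_def)
  then show "L2_on \<Omega> (\<lambda>x. v x + c)" by (rule L2_on_add)
  fix \<phi> i assume \<phi>: "test_function \<Omega> \<phi>"
  obtain C where C: "\<And>x. \<bar>partial_deriv i \<phi> x\<bar> \<le> C"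
    using bounded_range_partial_deriv_test_function[OF \<phi>] by blast
  have int: "integrable (lebesgue_on \<Omega>) (\<lambda>x. partial_deriv i \<phi> x * f x * 1)" if "L2_on \<Omega> f" for f
    using borel_measurable_partial_deriv_test_function[OF \<phi>] C that L2_on_const[OF \<Omega>(2)]
    by (rule integrable_bounded_times_L2_on)
  have "(LINT x|lebesgue_on \<Omega>. (v x + c) * partial_deriv i \<phi> x)
      = (LINT x|lebesgue_on \<Omega>. v x * partial_deriv i \<phi> x) + (LINT x|lebesgue_on \<Omega>. c * partial_deriv i \<phi> x)"
    using int[OF L2(1)] int[OF L2(2)]
    by (subst Bochner_Integration.integral_add[symmetric]) (auto simp: algebra_simps)
  also have "\<dots> = - (LINT x|lebesgue_on \<Omega>. G x $ i * \<phi> x)"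
    using v \<phi> by (simp add: H1_grad_def integral_partial_deriv_test_function[OF \<Omega>(1)])
  finally show "(LINT x|lebesgue_on \<Omega>. (v x + c) * partial_deriv i \<phi> x) = - (LINT x|lebesgue_on \<Omega>. G x $ i * \<phi> x)" .
qed

text \<open>Needed to pass from a solution that equals a constant almost everywhere to the constant
  function itself, which the hypothesis on constant solutions speaks of.\<close>

lemma H1_grad_cong_AE:
  assumes v: "H1_grad \<Omega> v G" and AE: "AE x in lebesgue_on \<Omega>. v x = w x" and w: "L2_on \<Omega> w"
  shows "H1_grad \<Omega> w G"
  unfolding H1_grad_def
proof (intro conjI allI impI)
  show "L2_on \<Omega> w" "L2_on \<Omega> G" using v w by (auto simp: H1_grad_def)
  have [measurable]: "v \<in> borel_measurable (lebesgue_on \<Omega>)" "w \<in> borel_measurable (lebesgue_on \<Omega>)"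
    using v w by (auto simp: H1_grad_def L2_on_def)
  fix \<phi> i assume \<phi>: "test_function \<Omega> \<phi>"
  note borel_measurable_partial_deriv_test_function[OF \<phi>, measurable]
  have "(LINT x|lebesgue_on \<Omega>. w x * partial_deriv i \<phi> x) = (LINT x|lebesgue_on \<Omega>. v x * partial_deriv i \<phi> x)"
    using AE by (intro integral_cong_AE) (auto elim!: eventually_mono)
  then show "(LINT x|lebesgue_on \<Omega>. w x * partial_deriv i \<phi> x) = - (LINT x|lebesgue_on \<Omega>. G x $ i * \<phi> x)"
    using v \<phi> by (simp add: H1_grad_def)
qed

text \<open>Both defining conditions of \<open>X_space\<close> are instances of the zero of the
  shifted power integral, with \<open>q = 2 / (p - 1)\<close> for finite \<open>p\<close> and
  \<open>q = 0\<close> for \<open>p = \<infinity>\<close>.\<close>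

lemma exists_shift_in_X_space:
  fixes \<Omega> :: "(real^'N) set"
  assumes \<Omega>: "\<Omega> \<in> sets lebesgue" "finite_measure (lebesgue_on \<Omega>)" and p: "1 < p"
    and v: "H1_grad \<Omega> v G"
  shows "\<exists>c. (\<lambda>x. v x + c) \<in> X_space \<Omega> p"
proof -
  have vm: "v \<in> borel_measurable (lebesgue_on \<Omega>)" using v by (auto simp: H1_grad_def L2_on_def)
  have H1: "(\<lambda>x. v x + c) \<in> H1 \<Omega>" for c
    using H1_grad_add_const[OF \<Omega> v] by (auto simp: H1_def)
  show ?thesis
  proof (cases "p = \<infinity>")
    case True
    obtain c where "(LINT x|lebesgue_on \<Omega>. \<bar>v x + c\<bar> powr 0 * (v x + c)) = 0"
      using exists_shift_integral_abs_powr_times_eq_0[OF \<Omega>(2) _ vm, of 0] by auto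
    moreover have "(\<lambda>x. \<bar>v x + c\<bar> powr 0 * (v x + c)) = (\<lambda>x. v x + c)" by auto
    ultimately have "(LINT x|lebesgue_on \<Omega>. v x + c) = 0" by metis
    then show ?thesis using H1 True by (auto simp: X_space_def)
  next
    case False
    then obtain r where r: "p = ereal r" "1 < r" using p by (cases p) auto
    then obtain c where
      "(LINT x|lebesgue_on \<Omega>. \<bar>v x + c\<bar> powr (2 / (r - 1)) * (v x + c)) = 0"
      using exists_shift_integral_abs_powr_times_eq_0[OF \<Omega>(2) _ vm, of "2 / (r - 1)"] by auto
    then show ?thesis using H1 r by (auto simp: X_space_def)
  qed
qed

section \<open>The strict inequality supplied by \<open>\<beta>\<close>\<close>

text \<open>An \<open>Inf\<close> of reals is a lower bound only if the set is bounded below; here 0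
  is a bound, \<open>I_functional\<close> being a quotient of nonnegative numbers.\<close>

lemma \<beta>_le_I_functional:
  assumes "v \<in> X_space \<Omega> p" "H1_grad \<Omega> v G" "\<not> (AE x in lebesgue_on \<Omega>. v x = 0)"
  shows "\<beta> \<Omega> p \<le> I_functional \<Omega> p v G"
  unfolding \<beta>_def
proof (rule cInf_lower)
  show "bdd_below {I_functional \<Omega> p v G | v G.
     v \<in> X_space \<Omega> p \<and> H1_grad \<Omega> v G \<and> \<not> (AE x in lebesgue_on \<Omega>. v x = 0)}"
    by (rule bdd_belowI[of _ 0]) (auto simp: I_functional_def)
qed (use assms in blast)

text \<open>With \<open>D\<close> the denominator of \<open>I_functional\<close> and
  \<open>E\<close> its numerator, the chain is \<open>\<integral> b v\<^sup>2 \<le> Lp_norm \<Omega>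
  p b * D < \<beta> \<Omega> p * D \<le> E\<close>. The first inequality is Hoelder's, or the
  essential bound on \<open>b\<close> if \<open>p = \<infinity>\<close>.\<close>

lemma integral_weight_times_square_less:
  fixes \<Omega> :: "(real^'N) set"
  assumes p: "1 < p"
    and b: "b \<in> borel_measurable (lebesgue_on \<Omega>)" "\<And>x. x \<in> \<Omega> \<Longrightarrow> 0 \<le> b x" "\<And>x. x \<in> \<Omega> \<Longrightarrow> b x \<le> C"
    and \<Omega>: "finite_measure (lebesgue_on \<Omega>)"
    and less: "Lp_norm \<Omega> p b < \<beta> \<Omega> p"
    and v: "v \<in> X_space \<Omega> p" "H1_grad \<Omega> v G" "\<not> (AE x in lebesgue_on \<Omega>. v x = 0)"
  shows "(LINT x|lebesgue_on \<Omega>. b x * (v x)\<^sup>2) < (LINT x|lebesgue_on \<Omega>. (norm (G x))\<^sup>2)"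
proof -
  interpret finite_measure "lebesgue_on \<Omega>" by (rule \<Omega>)
  note b(1) [measurable]
  have [measurable]: "v \<in> borel_measurable (lebesgue_on \<Omega>)"
    using v by (auto simp: H1_grad_def L2_on_def)
  have v2: "integrable (lebesgue_on \<Omega>) (\<lambda>x. (v x)\<^sup>2)" using v by (auto simp: H1_grad_def L2_on_def)
  have le: "\<beta> \<Omega> p \<le> I_functional \<Omega> p v G" by (rule \<beta>_le_I_functional[OF v])
  define E where "E = (LINT x|lebesgue_on \<Omega>. (norm (G x))\<^sup>2)"
  \<comment> \<open>Strictness requires \<open>D > 0\<close>. This follows from
    \<open>\<beta> \<Omega> p > 0\<close>, since for \<open>D = 0\<close> the quotient
    \<open>E / D\<close> would be 0.\<close>
  have step: "(LINT x|lebesgue_on \<Omega>. b x * (v x)\<^sup>2) < E"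
    if "(LINT x|lebesgue_on \<Omega>. b x * (v x)\<^sup>2) \<le> Lp_norm \<Omega> p b * D" "\<beta> \<Omega> p \<le> E / D" "0 \<le> D" "0 \<le> Lp_norm \<Omega> p b" for D
  proof -
    have "0 < \<beta> \<Omega> p" using less that by linarith
    then have "D \<noteq> 0" using that(2) by auto
    then have D: "0 < D" using that(3) by simp
    then have "Lp_norm \<Omega> p b * D < \<beta> \<Omega> p * D" using less by simp
    also have "\<dots> \<le> E" using that(2) D by (simp add: field_simps)
    finally show ?thesis using that(1) by linarith
  qed
  show ?thesis
    unfolding E_def[symmetric]
  proof (cases "p = \<infinity>")
    case True
    define S where "S = esssup (lebesgue_on \<Omega>) (\<lambda>x. ereal \<bar>b x\<bar>)"
    \<comment> \<open>The bound \<open>C\<close> excludes \<open>S = \<infinity>\<close>, which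
      \<open>real_of_ereal\<close> would send to 0.\<close>
    have "S \<le> ereal C"
      unfolding S_def using b by (intro esssup_I AE_I2) (auto simp: space_restrict_space)
    have norm: "Lp_norm \<Omega> p b = real_of_ereal S" using True by (simp add: Lp_norm_def S_def)
    have AE: "AE x in lebesgue_on \<Omega>. \<bar>b x\<bar> \<le> real_of_ereal S"
      using esssup_AE[of "\<lambda>x. ereal \<bar>b x\<bar>" "lebesgue_on \<Omega>", folded S_def]
    proof eventually_elim
      case (elim x)
      then show ?case using \<open>S \<le> ereal C\<close> by (cases S) auto
    qed
    \<comment> \<open>A negative bound on \<open>\<bar>b x\<bar>\<close> can hold almost everywhere
      only on a null space, where \<open>v\<close> would vanish almost everywhere.\<close>
    have S0: "0 \<le> real_of_ereal S"
    proof (rule ccontr)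
      assume "\<not> 0 \<le> real_of_ereal S"
      then have "AE x in lebesgue_on \<Omega>. v x = 0" using AE by (auto elim!: eventually_mono)
      then show False using v(3) by simp
    qed
    show "(LINT x|lebesgue_on \<Omega>. b x * (v x)\<^sup>2) < E"
    proof (rule step)
      have "(LINT x|lebesgue_on \<Omega>. b x * (v x)\<^sup>2) \<le> (LINT x|lebesgue_on \<Omega>. real_of_ereal S * (v x)\<^sup>2)"
        using AE v2 S0 by (intro integral_mono_AE') (auto elim!: eventually_mono intro!: mult_right_mono)
      then show "(LINT x|lebesgue_on \<Omega>. b x * (v x)\<^sup>2) \<le> Lp_norm \<Omega> p b * (LINT x|lebesgue_on \<Omega>. (v x)\<^sup>2)"
        using norm by simp
      show "\<beta> \<Omega> p \<le> E / (LINT x|lebesgue_on \<Omega>. (v x)\<^sup>2)"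
        using le True by (simp add: I_functional_def E_def)
    qed (use norm S0 in auto)
  next
    case False
    then obtain r where r: "p = ereal r" "1 < r" using p by (cases p) auto
    \<comment> \<open>\<open>q\<close> is the exponent conjugate to \<open>r\<close>, and
      \<open>D\<close> below is the norm of \<open>v\<^sup>2\<close> in the corresponding Lebesgue
      space; since \<open>1 / q = (r - 1) / r\<close>, it is exactly the denominator of
      \<open>I_functional\<close>.\<close>
    define q where "q = r / (r - 1)"
    have q: "1 < q" "1 / r + 1 / q = 1" using r by (auto simp: q_def field_simps)
    have pw: "(v x)\<^sup>2 powr q = \<bar>v x\<bar> powr (2 * r / (r - 1))" for x
    proof -
      have *: "(v x)\<^sup>2 = \<bar>v x\<bar> powr 2" by simp
      show ?thesis unfolding * powr_powr q_def by simp
    qed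
    define D where "D = (LINT x|lebesgue_on \<Omega>. (v x)\<^sup>2 powr q) powr (1 / q)"
    have D: "D = (LINT x|lebesgue_on \<Omega>. \<bar>v x\<bar> powr (2 * r / (r - 1))) powr ((r - 1) / r)"
      by (simp add: D_def pw) (simp add: q_def)
    have norm: "Lp_norm \<Omega> p b = (LINT x|lebesgue_on \<Omega>. b x powr r) powr (1 / r)"
      unfolding Lp_norm_def using r b(2)
      by (auto intro!: arg_cong[where f = "\<lambda>t. t powr _"] Bochner_Integration.integral_cong simp: space_restrict_space)
    have \<beta>D: "\<beta> \<Omega> p \<le> E / D" using le r by (simp add: I_functional_def D E_def)
    have pos: "0 < \<beta> \<Omega> p" using less norm by (smt (verit) powr_ge_zero)
    \<comment> \<open>A divergent integral would have the value 0 and make the quotient \<open>E / D\<close> equal to 0; so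
      \<open>\<beta> \<Omega> p > 0\<close> provides the integrability that is usually taken from the Sobolev embedding.\<close>
    have vq: "integrable (lebesgue_on \<Omega>) (\<lambda>x. (v x)\<^sup>2 powr q)"
    proof (rule ccontr)
      assume "\<not> ?thesis"
      then have "D = 0" by (simp add: D_def not_integrable_integral_eq)
      then show False using \<beta>D pos by simp
    qed
    have br: "integrable (lebesgue_on \<Omega>) (\<lambda>x. b x powr r)"
    proof (rule integrable_const_bound)
      show "AE x in lebesgue_on \<Omega>. norm (b x powr r) \<le> C powr r"
        using b r by (intro AE_I2) (auto simp: space_restrict_space intro!: powr_mono2)
    qed measurable
    show "(LINT x|lebesgue_on \<Omega>. b x * (v x)\<^sup>2) < E"
    proof (rule step)
      show "(LINT x|lebesgue_on \<Omega>. b x * (v x)\<^sup>2) \<le> Lp_norm \<Omega> p b * D"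
        unfolding norm D_def
        using r q b(2) br vq by (intro Holder_integral) (auto simp: space_restrict_space)
    qed (use norm \<beta>D in \<open>auto simp: D_def\<close>)
  qed
qed

section \<open>Quadratic forms in coordinates, bounds for continuous coefficients\<close>

lemma matrix_form_eq_sum:
  fixes M :: "real^'n^'n"
  shows "(M *v u) \<bullet> v = (\<Sum>i\<in>UNIV. \<Sum>j\<in>UNIV. M $ i $ j * u $ j * v $ i)"
  by (simp add: inner_vec_def matrix_vector_mult_def sum_distrib_right)

lemma diagonal_matrix_form:
  assumes "diagonal_matrix M"
  shows "(M *v v) \<bullet> v = (\<Sum>i\<in>UNIV. M $ i $ i * (v $ i)\<^sup>2)"
proof -
  have "(\<Sum>j\<in>UNIV. M $ i $ j * v $ j * v $ i) = M $ i $ i * (v $ i)\<^sup>2" for i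
  proof -
    have "(\<Sum>j\<in>UNIV. M $ i $ j * v $ j * v $ i) = (\<Sum>j\<in>UNIV. if j = i then M $ i $ i * (v $ i)\<^sup>2 else 0)"
      using assms by (intro sum.cong) (auto simp: diagonal_matrix_def power2_eq_square)
    then show ?thesis by simp
  qed
  then show ?thesis by (simp add: matrix_form_eq_sum)
qed

lemma continuous_on_closure_bounded:
  fixes f :: "'a::euclidean_space \<Rightarrow> real"
  assumes "bounded \<Omega>" "continuous_on (closure \<Omega>) f"
  obtains C where "\<And>x. x \<in> \<Omega> \<Longrightarrow> \<bar>f x\<bar> \<le> C"
proof -
  have "bounded (f ` closure \<Omega>)"
    using assms by (meson compact_closure compact_continuous_image compact_imp_bounded)
  then obtain C where "\<And>x. x \<in> closure \<Omega> \<Longrightarrow> \<bar>f x\<bar> \<le> C" by (auto simp: bounded_iff)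
  then show ?thesis using that closure_subset[of \<Omega>] by blast
qed

section \<open>Reduction of an arbitrary solution to a constant one\<close>

theorem theorem3p2:
  fixes \<Omega> :: "(real^'N) set"
    and A B :: "real^'N \<Rightarrow> real^'n^'n"
    and p :: "'n \<Rightarrow> ereal"
  assumes "CARD('N) \<ge> 2"
    and "bounded_regular_domain \<Omega>"
    and "\<And>x. x \<in> closure \<Omega> \<Longrightarrow> transpose (A x) = A x"
    and "\<And>i j. continuous_on (closure \<Omega>) (\<lambda>x. A x $ i $ j)"
    and "\<And>k :: real^'n. neumann_solution \<Omega> A (\<lambda>x. k) \<Longrightarrow> k = 0"
    and "\<And>k :: real^'n. (LINT x|lebesgue_on \<Omega>. (A x *v k) \<bullet> k) \<ge> 0"
    and "\<And>x. x \<in> closure \<Omega> \<Longrightarrow> diagonal_matrix (B x)"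
    and "\<And>i. continuous_on (closure \<Omega>) (\<lambda>x. B x $ i $ i)"
    and "\<And>i. ereal (real CARD('N) / 2) < p i"
    and "\<And>x. x \<in> closure \<Omega> \<Longrightarrow> matrix_le (A x) (B x)"
    and "\<And>i. Lp_norm \<Omega> (p i) (\<lambda>x. max (B x $ i $ i) 0) < \<beta> \<Omega> (p i)"
  shows "\<not> (\<exists>u. neumann_solution \<Omega> A u \<and> \<not> (AE x in lebesgue_on \<Omega>. u x = 0))"
proof
  assume "\<exists>u. neumann_solution \<Omega> A u \<and> \<not> (AE x in lebesgue_on \<Omega>. u x = 0)"
  then obtain u where u: "neumann_solution \<Omega> A u" and nz: "\<not> (AE x in lebesgue_on \<Omega>. u x = 0)"
    by blast
  let ?M = "lebesgue_on \<Omega>"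
  have \<Omega>: "open \<Omega>" "bounded \<Omega>" using assms(2) by (auto simp: bounded_regular_domain_def)
  then have sets: "\<Omega> \<in> sets lebesgue" by auto
  have fin: "finite_measure ?M"
    using bounded_set_imp_lmeasurable[OF \<Omega>(2) sets] by (rule finite_measure_lebesgue_on)
  have cl: "x \<in> closure \<Omega>" if "x \<in> \<Omega>" for x using that closure_subset by auto
  have meas: "f \<in> borel_measurable ?M" if "continuous_on (closure \<Omega>) f" for f :: "real^'N \<Rightarrow> real"
    using continuous_imp_measurable_on_sets_lebesgue[OF continuous_on_subset[OF that closure_subset] sets] .
  have p1: "1 < p i" for i
  proof -
    have "1 \<le> ereal (real CARD('N) / 2)" using assms(1) by (simp add: one_ereal_def)
    then show ?thesis using assms(9)[of i] by (rule le_less_trans)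
  qed
  obtain G :: "real^'N \<Rightarrow> real^'N^'n" where G: "\<And>i. H1_grad \<Omega> (\<lambda>x. u x $ i) (\<lambda>x. G x $ i)"
    and weak: "\<And>v H. (\<And>i. H1_grad \<Omega> (\<lambda>x. v x $ i) (\<lambda>x. H x $ i)) \<Longrightarrow>
           (\<Sum>i\<in>UNIV. LINT x|?M. G x $ i \<bullet> H x $ i) = (LINT x|?M. (A x *v u x) \<bullet> v x)"
    using u unfolding neumann_solution_def by blast
  have uL2: "L2_on \<Omega> (\<lambda>x. u x $ i)" for i using G[of i] by (auto simp: H1_grad_def)
  have kL2: "L2_on \<Omega> (\<lambda>x. c)" for c :: real using fin by (rule L2_on_const)
  have intA: "integrable ?M (\<lambda>x. (A x *v f x) \<bullet> g x)"
    if "\<And>i. L2_on \<Omega> (\<lambda>x. f x $ i)" "\<And>i. L2_on \<Omega> (\<lambda>x. g x $ i)" for f g :: "real^'N \<Rightarrow> real^'n"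
    unfolding matrix_form_eq_sum
  proof (intro Bochner_Integration.integrable_sum)
    fix i j
    obtain C where "\<And>x. x \<in> \<Omega> \<Longrightarrow> \<bar>A x $ i $ j\<bar> \<le> C"
      using continuous_on_closure_bounded[OF \<Omega>(2) assms(4)] by blast
    then show "integrable ?M (\<lambda>x. A x $ i $ j * f x $ j * g x $ i)"
      by (intro integrable_bounded_times_L2_on meas assms(4) that)
  qed
  have "\<exists>c. (\<lambda>x. u x $ i + c) \<in> X_space \<Omega> (p i)" for i
    using sets fin p1 G by (rule exists_shift_in_X_space)
  then obtain c where c: "\<And>i. (\<lambda>x. u x $ i + c i) \<in> X_space \<Omega> (p i)" by metis
  define k :: "real^'n" where "k = (\<chi> i. c i)"
  define w where "w x = u x + k" for x
  have w: "(\<lambda>x. w x $ i) \<in> X_space \<Omega> (p i)" "H1_grad \<Omega> (\<lambda>x. w x $ i) (\<lambda>x. G x $ i)" for i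
    using c[of i] H1_grad_add_const[OF sets fin G[of i]] by (auto simp: w_def k_def)
  have wL2: "L2_on \<Omega> (\<lambda>x. w x $ i)" for i using w(2)[of i] by (auto simp: H1_grad_def)
  define b where "b i x = max (B x $ i $ i) 0" for i x
  have b_meas: "b i \<in> borel_measurable ?M" for i
    using meas[OF assms(8)[of i]] unfolding b_def by measurable
  obtain C where C: "\<And>i x. x \<in> \<Omega> \<Longrightarrow> b i x \<le> C i"
  proof -
    have "\<exists>C. \<forall>x\<in>\<Omega>. b i x \<le> C" for i
      using continuous_on_closure_bounded[OF \<Omega>(2) assms(8)[of i]] unfolding b_def
      by (metis abs_ge_self abs_ge_zero max.bounded_iff order_trans)
    then show ?thesis using that by metis
  qed
  have b_bound: "\<bar>b i x\<bar> \<le> C i" if "x \<in> \<Omega>" for i x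
    using C[OF that, of i] by (auto simp: b_def)
  have b_int: "integrable ?M (\<lambda>x. b i x * (w x $ i)\<^sup>2)" for i
    using integrable_bounded_times_L2_on[OF b_meas b_bound wL2 wL2, of i i i]
    by (simp add: power2_eq_square mult.assoc)
  define E where "E i = (LINT x|?M. (norm (G x $ i))\<^sup>2)" for i
  define T where "T i = (LINT x|?M. b i x * (w x $ i)\<^sup>2)" for i

  have energy: "(\<Sum>i\<in>UNIV. E i) = (LINT x|?M. (A x *v u x) \<bullet> u x)"
    using weak[OF G] by (simp add: E_def power2_norm_eq_inner)
  have orth: "(LINT x|?M. (A x *v u x) \<bullet> k) = 0"
    using weak[of "\<lambda>x. k" "\<lambda>x. 0"] H1_grad_const[OF sets fin] by simp
  \<comment> \<open>The three integrals are the expansion of the quadratic form of \<open>A\<close>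
    at \<open>w = u + k\<close>: the first is the energy, the second is 0 by \<open>orth\<close>,
    the third is nonnegative by hypothesis.\<close>
  have "(\<Sum>i\<in>UNIV. E i) \<le> (LINT x|?M. (A x *v u x) \<bullet> u x) + 2 * (LINT x|?M. (A x *v u x) \<bullet> k)
      + (LINT x|?M. (A x *v k) \<bullet> k)"
    using energy orth assms(6)[of k] by simp
  also have "\<dots> = (LINT x|?M. (A x *v u x) \<bullet> u x + 2 * ((A x *v u x) \<bullet> k) + (A x *v k) \<bullet> k)"
    using intA[of u u] intA[of u "\<lambda>x. k"] intA[of "\<lambda>x. k" "\<lambda>x. k"] uL2 kL2 by simp
  also have "\<dots> = (LINT x|?M. (A x *v w x) \<bullet> w x)"
  proof (intro Bochner_Integration.integral_cong refl)
    fix x assume "x \<in> space ?M"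
    then have "transpose (A x) = A x" using assms(3) cl by (simp add: space_restrict_space)
    \<comment> \<open>Symmetry of \<open>A x\<close> merges the two cross terms into one doubled
      term.\<close>
    then have "(A x *v k) \<bullet> u x = (A x *v u x) \<bullet> k"
      by (metis dot_lmul_matrix inner_commute transpose_matrix_vector)
    then show "(A x *v u x) \<bullet> u x + 2 * ((A x *v u x) \<bullet> k) + (A x *v k) \<bullet> k = (A x *v w x) \<bullet> w x"
      by (simp add: w_def matrix_vector_right_distrib inner_add_left inner_add_right)
  qed
  also have "\<dots> \<le> (LINT x|?M. (\<Sum>i\<in>UNIV. b i x * (w x $ i)\<^sup>2))"
  proof (rule integral_mono)
    fix x assume "x \<in> space ?M"
    then have x: "x \<in> closure \<Omega>" using cl by (simp add: space_restrict_space)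
    have "(A x *v w x) \<bullet> w x \<le> (B x *v w x) \<bullet> w x"
      using assms(10)[OF x] by (simp add: matrix_le_def matrix_vector_mult_diff_rdistrib inner_diff_left)
    also have "\<dots> \<le> (\<Sum>i\<in>UNIV. b i x * (w x $ i)\<^sup>2)"
      unfolding diagonal_matrix_form[OF assms(7)[OF x]] by (intro sum_mono mult_right_mono) (auto simp: b_def)
    finally show "(A x *v w x) \<bullet> w x \<le> (\<Sum>i\<in>UNIV. b i x * (w x $ i)\<^sup>2)" .
  qed (use intA[of w w] wL2 b_int in auto)
  also have "\<dots> = (\<Sum>i\<in>UNIV. T i)" using b_int by (simp add: T_def)
  finally have le: "(\<Sum>i\<in>UNIV. E i) \<le> (\<Sum>i\<in>UNIV. T i)" .

  have T_less: "T i < E i" if "\<not> (AE x in ?M. w x $ i = 0)" for i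
    unfolding T_def E_def
    using p1 b_meas _ C fin _ w that
    by (rule integral_weight_times_square_less) (use assms(11)[of i] in \<open>auto simp: b_def[abs_def]\<close>)
  have T_zero: "T i \<le> E i" if "AE x in ?M. w x $ i = 0" for i
  proof -
    have "T i = 0" unfolding T_def using that by (intro integral_eq_zero_AE) auto
    then show ?thesis by (simp add: E_def)
  qed
  \<comment> \<open>\<open>T i \<le> E i\<close> holds for every component, so a single nonvanishing
    one makes the inequality of the sums strict, against \<open>le\<close>.\<close>
  have "AE x in ?M. w x $ i = 0" for i
  proof (rule ccontr)
    assume "\<not> ?thesis"
    then have "(\<Sum>i\<in>UNIV. T i) < (\<Sum>i\<in>UNIV. E i)"
      using T_less T_zero by (intro sum_strict_mono_ex1) (auto intro: less_imp_le)
    then show False using le by simp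
  qed
  then have "AE x in ?M. \<forall>i. w x $ i = 0" by (simp add: AE_all_countable)
  then have uk: "AE x in ?M. u x = - k"
    by eventually_elim (simp add: w_def vec_eq_iff add_eq_0_iff)

  \<comment> \<open>The gradient \<open>G\<close> of \<open>u\<close> is kept as a weak gradient of
    the constant \<open>- k\<close>, so the weak equation carries over with its left-hand side
    unchanged.\<close>
  have "neumann_solution \<Omega> A (\<lambda>x. - k)"
    unfolding neumann_solution_def
  proof (intro exI[of _ G] conjI allI impI)
    show "H1_grad \<Omega> (\<lambda>x. (- k) $ i) (\<lambda>x. G x $ i)" for i
      using uk kL2 by (intro H1_grad_cong_AE[OF G[of i]]) (auto elim!: eventually_mono)
    fix v :: "real^'N \<Rightarrow> real^'n" and H :: "real^'N \<Rightarrow> real^'N^'n"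
    assume H: "\<forall>i. H1_grad \<Omega> (\<lambda>x. v x $ i) (\<lambda>x. H x $ i)"
    then have vL2: "L2_on \<Omega> (\<lambda>x. v x $ i)" for i by (auto simp: H1_grad_def)
    have "(\<Sum>i\<in>UNIV. LINT x|?M. G x $ i \<bullet> H x $ i) = (LINT x|?M. (A x *v u x) \<bullet> v x)"
      using H by (intro weak) auto
    also have "\<dots> = (LINT x|?M. (A x *v - k) \<bullet> v x)"
      using uk intA[of u v] intA[of "\<lambda>x. - k" v] uL2 kL2 vL2
      by (intro integral_cong_AE) (auto elim!: eventually_mono)
    finally show "(\<Sum>i\<in>UNIV. LINT x|?M. G x $ i \<bullet> H x $ i) = (LINT x|?M. (A x *v - k) \<bullet> v x)" .
  qed
  then have "- k = 0" by (rule assms(5))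
  then show False using uk nz by simp
qed

end
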